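(* Assume that the map $h\mapsto J''(\bar x)h^2$ is weak-$\star$ lower semicontinuous, that $J'(\bar x)\in-\mathcal N_C^\star(\bar x)$, that the non-degeneracy condition (NDC) holds, and that one of the following conditions is satisfied: (i) the map $h\mapsto J''(\bar x)h^2$ is weak-$\star$ upper semicontinuous; (ii) $C$ satisfies the Mosco regularity condition (MRC) in $(\bar x,J'(\bar x))$. Then the condition $$Q_C^{\bar x,J'(\bar x)}(h)+J''(\bar x)h^2>0\qquad\forall h\in\mathcal K_C^\star(\bar x,J'(\bar x))\setminus\{0\}$$ is equivalent to the existence of constants $c>0$ and $\varepsilon>0$ such that $$J(x)\ge J(\bar x)+\frac c2\|x-\bar x\|_X^2\qquad\forall x\in C\cap B_\varepsilon^X(\bar x).$$
   Context: Standing assumptions: $X$ is the topological dual of a separable Banach space $Y$; $\iota:Y\to X^\star$ is the canonical embedding; $C\subset X$ is closed and non-empty; $\bar x\in C$ is fixed; $B_\varepsilon^X(\bar x)$ is the closed ball of radius $\varepsilon$ around $\bar x$. The function $J:C\to\mathbb R$ is such that there exist $J'(\bar x)\in\iota(Y)$ and a bounded bilinear form $J''(\bar x):X\times X\to\mathbb R$ with $$\lim_{k\to\infty}\frac{J(\bar x+t_kh_k)-J(\bar x)-t_kJ'(\bar x)h_k-\frac12t_k^2J''(\bar x)h_k^2}{t_k^2}=0$$ for all $\{h_k\}\subset X$, $\{t_k\}\subset\mathbb R^+$ with $t_k\searrow0$, $h_k\stackrel{\star}{\rightharpoonup}h\in X$ (weak-$\star$ convergence) and $\bar x+t_kh_k\in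 C$. Here $J'(\bar x)h:=\langle J'(\bar x),h\rangle$ and $J''(\bar x)h^2:=J''(\bar x)(h,h)$. For $x\in C$: the weak-$\star$ outer tangent cone is $\mathcal T_C^\star(x):=\{h\in X\mid\exists t_k\searrow0,\ \exists x_k\in C:\ (x_k-x)/t_k\stackrel{\star}{\rightharpoonup}h\}$; the weak-$\star$ normal cone is $\mathcal N_C^\star(x):=\{x^\star\in\iota(Y)\mid\langle x^\star,h\rangle\le0\ \forall h\in\mathcal T_C^\star(x)\}$; for $\varphi\in-\mathcal N_C^\star(x)$ the critical cone is $\mathcal K_C^\star(x,\varphi):=\mathcal T_C^\star(x)\cap\varphi^\perp$, where $\varphi^\perp=\{h\in X\mid\langle\varphi,h\rangle=0\}$. Directional curvature functional: for $x\in C$, $\varphi\in-\mathcal N_C^\star(x)$, define $Q_C^{x,\varphi}:\mathcal K_C^\star(x,\varphi)\to[-\infty,\infty]$ by $$Q_C^{x,\varphi}(h):=\inf\Big\{\liminf_{k\to\infty}\langle\varphi,r_k\rangle\ \Big|\ \{r_k\}\subset X,\{t_k\}\subset\mathbb R^+:\ t_k\searrow0,\ t_kr_k\stackrel{\star}{\rightharpoonup}0,\ x+t_kh+\tfrac12t_k^2r_k\in C\Big\}.$$ (MRC) in $(x,\varphi)\in C\times-\mathcal N_C^\star(x)$: for every $h\in\mathcal K_C^\star(x,\varphi)$ there exist $\{r_k\}\subset X$, $\{t_k\}\subset\mathbb R^+$ with $t_k\searrow0$, $t_kr_k\to0$ strongly in $X$, $x+t_kh+\frac12t_k^2r_k\in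 C$ and $Q_C^{x,\varphi}(h)=\lim_{k\to\infty}\langle\varphi,r_k\rangle$. (NDC): for all $\{h_k\}\subset X$, $\{t_k\}\subset\mathbb R^+$ with $\bar x+t_kh_k\in C$, $h_k\stackrel{\star}{\rightharpoonup}0$, $t_k\searrow0$ and $\|h_k\|_X=1$, it holds $\liminf_{k\to\infty}\big(\langle J'(\bar x),h_k/t_k\rangle+\frac12J''(\bar x)h_k^2\big)>0$. *)

theory Defs
  imports "HOL-Analysis.Analysis"
begin

text \<open>
  \<open>Y\<close> is the Banach space \<open>'a\<close>, its topological dual \<open>X\<close> is \<open>'a \<Rightarrow>\<^sub>L real\<close> (with the operator norm),
  and the dual of \<open>X\<close> is \<open>('a \<Rightarrow>\<^sub>L real) \<Rightarrow>\<^sub>L real\<close>.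
\<close>

type_synonym 'a dual = "'a \<Rightarrow>\<^sub>L real"

definition canonical_embedding :: "'a::real_normed_vector \<Rightarrow> 'a dual dual" where
  "canonical_embedding y = Blinfun (\<lambda>x. blinfun_apply x y)"

lemma canonical_embedding_apply:
  "blinfun_apply (canonical_embedding y) x = blinfun_apply x y"
  unfolding canonical_embedding_def
  by (simp add: bounded_linear_Blinfun_apply blinfun.bounded_linear_left)

definition weak_star_LIMSEQ :: "(nat \<Rightarrow> ('a::real_normed_vector) dual) \<Rightarrow> 'a dual \<Rightarrow> bool" where
  "weak_star_LIMSEQ h l \<longleftrightarrow> (\<forall>y. (\<lambda>k. blinfun_apply (h k) y) \<longlonglongrightarrow> blinfun_apply l y)"

text \<open>For real-valued functionals, the library's strong operator topology is the weak-star topology.\<close>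

lemma weak_star_LIMSEQ_iff_limitin:
  "weak_star_LIMSEQ h l \<longleftrightarrow> limitin strong_operator_topology h l sequentially"
proof -
  have "limitin strong_operator_topology h l sequentially
          \<longleftrightarrow> limitin euclidean (\<lambda>k. blinfun_apply (h k)) (blinfun_apply l) sequentially"
  proof (intro iffI)
    assume "limitin strong_operator_topology h l sequentially"
    moreover have "continuous_map strong_operator_topology euclidean
                     (blinfun_apply :: 'a dual \<Rightarrow> 'a \<Rightarrow> real)"
      using continuous_map_pullback[of euclidean euclidean id UNIV
          "blinfun_apply :: 'a dual \<Rightarrow> 'a \<Rightarrow> real"]
      by (simp add: strong_operator_topology_def)
    ultimately show "limitin euclidean (\<lambda>k. blinfun_apply (h k)) (blinfun_apply l) sequentially"
      using continuous_map_limit[of strong_operator_topology euclidean blinfun_apply h l sequentially]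
      by (simp add: comp_def)
  next
    assume L: "limitin euclidean (\<lambda>k. blinfun_apply (h k)) (blinfun_apply l) sequentially"
    show "limitin strong_operator_topology h l sequentially"
      unfolding limitin_def
    proof (intro conjI allI impI)
      fix U assume U: "openin strong_operator_topology U \<and> l \<in> U"
      then obtain V where V: "open V" "U = blinfun_apply -` V"
        by (auto simp: strong_operator_topology_def openin_pullback_topology)
      then show "\<forall>\<^sub>F k in sequentially. h k \<in> U"
        using L U by (auto simp: limitin_def)
    qed (simp add: strong_operator_topology_topspace)
  qed
  also have "\<dots> \<longleftrightarrow> weak_star_LIMSEQ h l"
    by (simp add: weak_star_LIMSEQ_def limitin_componentwise flip: euclidean_product_topology)
  finally show ?thesis by simp
qed

text \<open>
  Semicontinuity is understood sequentially, like all other notions below. For quadratic forms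
  on an infinite-dimensional \<open>X\<close> the topological version would be much more restrictive.
\<close>

definition weak_star_lsc :: "(('a::real_normed_vector) dual \<Rightarrow> real) \<Rightarrow> bool" where
  "weak_star_lsc f \<longleftrightarrow>
     (\<forall>h l. weak_star_LIMSEQ h l \<longrightarrow> ereal (f l) \<le> liminf (\<lambda>k. ereal (f (h k))))"

definition weak_star_usc :: "(('a::real_normed_vector) dual \<Rightarrow> real) \<Rightarrow> bool" where
  "weak_star_usc f \<longleftrightarrow>
     (\<forall>h l. weak_star_LIMSEQ h l \<longrightarrow> limsup (\<lambda>k. ereal (f (h k))) \<le> ereal (f l))"

text \<open>The convergence \<open>t\<^sub>k \<searrow> 0\<close> for positive reals; monotonicity is not required.\<close>

definition pos_null_seq :: "(nat \<Rightarrow> real) \<Rightarrow> bool" where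
  "pos_null_seq t \<longleftrightarrow> (\<forall>k. 0 < t k) \<and> t \<longlonglongrightarrow> 0"

definition tangent_cone :: "('a::real_normed_vector) dual set \<Rightarrow> 'a dual \<Rightarrow> 'a dual set" where
  "tangent_cone C x =
     {h. \<exists>t z. pos_null_seq t \<and> (\<forall>k. z k \<in> C) \<and>
               weak_star_LIMSEQ (\<lambda>k. (z k - x) /\<^sub>R t k) h}"

definition normal_cone :: "('a::real_normed_vector) dual set \<Rightarrow> 'a dual \<Rightarrow> 'a dual dual set" where
  "normal_cone C x =
     {\<phi> \<in> range canonical_embedding. \<forall>h\<in>tangent_cone C x. blinfun_apply \<phi> h \<le> 0}"

definition critical_cone ::
  "('a::real_normed_vector) dual set \<Rightarrow> 'a dual \<Rightarrow> 'a dual dual \<Rightarrow> 'a dual set" where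
  "critical_cone C x \<phi> = tangent_cone C x \<inter> {h. blinfun_apply \<phi> h = 0}"

text \<open>Only relevant for \<open>h \<in> critical_cone C x \<phi>\<close>; the infimum of the empty set is \<open>\<infinity>\<close>.\<close>

definition directional_curvature ::
  "('a::real_normed_vector) dual set \<Rightarrow> 'a dual \<Rightarrow> 'a dual dual \<Rightarrow> 'a dual \<Rightarrow> ereal" where
  "directional_curvature C x \<phi> h =
     Inf {liminf (\<lambda>k. ereal (blinfun_apply \<phi> (r k))) | r t.
            pos_null_seq t \<and> weak_star_LIMSEQ (\<lambda>k. t k *\<^sub>R r k) 0 \<and>
            (\<forall>k. x + t k *\<^sub>R h + ((1/2) * (t k)\<^sup>2) *\<^sub>R r k \<in> C)}"

definition Mosco_regular ::
  "('a::real_normed_vector) dual set \<Rightarrow> 'a dual \<Rightarrow> 'a dual dual \<Rightarrow> bool" where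
  "Mosco_regular C x \<phi> \<longleftrightarrow>
     (\<forall>h\<in>critical_cone C x \<phi>. \<exists>r t.
        pos_null_seq t \<and> (\<lambda>k. t k *\<^sub>R r k) \<longlonglongrightarrow> 0 \<and>
        (\<forall>k. x + t k *\<^sub>R h + ((1/2) * (t k)\<^sup>2) *\<^sub>R r k \<in> C) \<and>
        (\<lambda>k. ereal (blinfun_apply \<phi> (r k))) \<longlonglongrightarrow> directional_curvature C x \<phi> h)"

text \<open>
  The functional \<open>J\<close> is only defined on \<open>C\<close>; it is modelled by a total function
  whose values outside \<open>C\<close> are never used.
\<close>

definition second_order_expansion ::
  "('a::real_normed_vector) dual set \<Rightarrow> 'a dual \<Rightarrow> ('a dual \<Rightarrow> real) \<Rightarrow>
    'a dual dual \<Rightarrow> ('a dual \<Rightarrow> 'a dual \<Rightarrow> real) \<Rightarrow> bool" where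
  "second_order_expansion C x J J' J'' \<longleftrightarrow>
     (\<forall>h t l. pos_null_seq t \<and> weak_star_LIMSEQ h l \<and> (\<forall>k. x + t k *\<^sub>R h k \<in> C) \<longrightarrow>
        (\<lambda>k. (J (x + t k *\<^sub>R h k) - J x - t k * blinfun_apply J' (h k)
               - (1/2) * (t k)\<^sup>2 * J'' (h k) (h k)) / (t k)\<^sup>2) \<longlonglongrightarrow> 0)"

definition non_degenerate ::
  "('a::real_normed_vector) dual set \<Rightarrow> 'a dual \<Rightarrow>
    'a dual dual \<Rightarrow> ('a dual \<Rightarrow> 'a dual \<Rightarrow> real) \<Rightarrow> bool" where
  "non_degenerate C x J' J'' \<longleftrightarrow>
     (\<forall>h t. (\<forall>k. x + t k *\<^sub>R h k \<in> C) \<and> weak_star_LIMSEQ h 0 \<and> pos_null_seq t \<and>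
            (\<forall>k. norm (h k) = 1) \<longrightarrow>
        liminf (\<lambda>k. ereal (blinfun_apply J' (h k /\<^sub>R t k) + (1/2) * J'' (h k) (h k))) > 0)"

end

theory Submission
  imports Defs "HOL-Complex_Analysis.Great_Picard"
begin

text \<open>
  The two directions rest on the substitution
  \<open>h\<^sub>k = h + (t\<^sub>k / 2) r\<^sub>k\<close>, which turns a second order curve
  \<open>xb + t\<^sub>k h + (t\<^sub>k\<^sup>2 / 2) r\<^sub>k\<close> into a first order curve
  \<open>xb + t\<^sub>k h\<^sub>k\<close> with \<open>h\<^sub>k\<close> converging weak-star to
  \<open>h\<close>, and back. If \<open>J' h = 0\<close>, then the first order term satisfies
  \<open>2 J' h\<^sub>k / t\<^sub>k = J' r\<^sub>k\<close>, so that the expansion of \<open>J\<close> reads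
  \<open>2 (J (xb + t\<^sub>k h\<^sub>k) - J xb) / t\<^sub>k\<^sup>2 = J' r\<^sub>k + J'' h\<^sub>k h\<^sub>k + o(1)\<close>.

  Suppose that quadratic growth holds. Then the left-hand side is at least
  \<open>c \<parallel>h\<^sub>k\<parallel>\<^sup>2\<close> up to \<open>o(1)\<close>, and weak-star lower
  semicontinuity of the norm gives
  \<open>liminf J' r\<^sub>k \<ge> c \<parallel>h\<parallel>\<^sup>2 - J'' h h\<close> as soon as
  \<open>limsup J'' h\<^sub>k h\<^sub>k \<le> J'' h h\<close>
  (lemma \<open>quadratic_growth_imp_liminf_bound\<close>). This upper bound holds for all admissible
  sequences if the quadratic form is weak-star upper semicontinuous. Under Mosco regularity it is needed
  only for one sequence that attains the curvature, and along that one \<open>h\<^sub>k\<close> converges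
  strongly.

  Suppose that quadratic growth fails. Then there are points of \<open>C\<close> tending to \<open>xb\<close>
  at which growth is violated with constants tending to \<open>0\<close>; their normalised differences
  \<open>h\<^sub>k\<close> with \<open>xb\<close> have a weak-star limit \<open>l\<close> along a subsequence,
  because the predual is separable (lemma \<open>no_quadratic_growth_sequence\<close>). The non-degeneracy
  condition excludes \<open>l = 0\<close>. Otherwise \<open>l\<close> is a critical direction, and reading the
  substitution backwards makes \<open>r\<^sub>k = 2 (h\<^sub>k - l) / t\<^sub>k\<close> a competitor in
  the curvature; with weak-star lower semicontinuity of the quadratic form, the displayed identity
  contradicts strict positivity of \<open>Q l + J'' l l\<close>.
\<close>

section \<open>Weak-star convergent sequences in a dual space\<close>

text \<open>
  Sequential Banach--Alaoglu: pass to a subsequence that converges pointwise on a countable dense set;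
  the uniform norm bound makes the functionals equicontinuous, which carries the Cauchy property
  from the dense set to every point.
\<close>

lemma weak_star_convergent_subsequence:
  fixes h :: "nat \<Rightarrow> 'a::real_normed_vector dual"
  assumes sep: "separable_space (euclidean :: 'a topology)"
    and bd: "\<And>n. norm (h n) \<le> M"
  obtains s l where "strict_mono (s :: nat \<Rightarrow> nat)" "weak_star_LIMSEQ (h \<circ> s) l"
proof -
  obtain D :: "'a set" where D: "countable D" "closure D = UNIV"
    using sep by (auto simp: separable_space_def)
  have M0: "0 \<le> M"
    using bd[of 0] norm_ge_zero order_trans by blast
  have lip: "\<bar>h n y\<bar> \<le> M * norm y" for n y
    using norm_blinfun[of "h n" y] bd[of n] mult_right_mono[OF bd[of n], of "norm y"] by auto
  have bound: "norm (h n (sgn y)) \<le> M" for n y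
  proof -
    have "\<bar>h n (sgn y)\<bar> \<le> M * norm (sgn y)"
      by (rule lip)
    also have "\<dots> \<le> M * 1"
      using M0 by (intro mult_left_mono) (auto simp: norm_sgn)
    finally show ?thesis by simp
  qed
  \<comment> \<open>The vectors are normalised because the extraction lemma asks for one bound on all of \<open>D\<close>.\<close>
  obtain s where s: "strict_mono (s :: nat \<Rightarrow> nat)"
    and ex: "\<And>y. y \<in> D \<Longrightarrow> \<exists>l. (\<lambda>n. h (s n) (sgn y)) \<longlonglongrightarrow> l"
    using function_convergent_subsequence[of D "\<lambda>n y. h n (sgn y)" M] D(1) bound by blast
  have convD: "convergent (\<lambda>n. h (s n) y)" if "y \<in> D" for y
  proof -
    obtain l where "(\<lambda>n. h (s n) (sgn y)) \<longlonglongrightarrow> l"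
      using ex[OF \<open>y \<in> D\<close>] by blast
    then have "(\<lambda>n. norm y * h (s n) (sgn y)) \<longlonglongrightarrow> norm y * l"
      by (intro tendsto_intros)
    moreover have "norm y * h (s n) (sgn y) = h (s n) y" for n
      by (cases "y = 0") (simp_all add: sgn_div_norm blinfun.scaleR_right)
    ultimately show ?thesis
      by (auto simp: convergent_def)
  qed
  have "Cauchy (\<lambda>n. h (s n) y)" for y
  proof (rule metric_CauchyI)
    fix e :: real assume "0 < e"
    then have "0 < e / (3 * (M + 1))" using M0 by simp
    then obtain d where d: "d \<in> D" "dist d y < e / (3 * (M + 1))"
      using D(2) closure_approachable by (metis UNIV_I)
    have "(M + 1) * norm (y - d) < e / 3"
      using d(2) M0 by (simp add: dist_norm norm_minus_commute field_simps)
    then have Md: "M * norm (y - d) < e / 3"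
      by (smt (verit) mult_right_mono norm_ge_zero)
    have "Cauchy (\<lambda>n. h (s n) d)"
      using convD[OF d(1)] Cauchy_convergent_iff by blast
    then obtain N where N: "\<And>m n. m \<ge> N \<Longrightarrow> n \<ge> N \<Longrightarrow> dist (h (s m) d) (h (s n) d) < e / 3"
      using \<open>0 < e\<close> by (meson metric_CauchyD zero_less_divide_iff zero_less_numeral)
    show "\<exists>N. \<forall>m\<ge>N. \<forall>n\<ge>N. dist (h (s m) y) (h (s n) y) < e"
    proof (intro exI allI impI)
      fix m n assume mn: "N \<le> m" "N \<le> n"
      have "\<bar>h (s k) y - h (s k) d\<bar> < e / 3" for k
        using lip[of "s k" "y - d"] Md by (simp add: blinfun.diff_right)
      from this[of m] this[of n] N[OF mn] show "dist (h (s m) y) (h (s n) y) < e"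
        unfolding dist_real_def by linarith
    qed
  qed
  then have "\<forall>y. \<exists>l. (\<lambda>n. h (s n) y) \<longlonglongrightarrow> l"
    using Cauchy_convergent_iff convergent_def by blast
  then obtain v where v: "\<And>y. (\<lambda>n. h (s n) y) \<longlonglongrightarrow> v y"
    by metis
  have "bounded_linear v"
  proof (rule bounded_linear_intro)
    fix x y :: 'a and r :: real
    show "v (x + y) = v x + v y"
      using tendsto_add[OF v[of x] v[of y]] v[of "x + y"]
      by (simp add: blinfun.add_right LIMSEQ_unique)
    show "v (r *\<^sub>R x) = r *\<^sub>R v x"
      using tendsto_scaleR[OF tendsto_const[of r] v[of x]] v[of "r *\<^sub>R x"]
      by (simp add: blinfun.scaleR_right LIMSEQ_unique)
    show "norm (v x) \<le> norm x * M"
      by (rule LIMSEQ_le_const2[OF tendsto_norm[OF v[of x]]])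
        (use lip in \<open>auto simp: mult.commute\<close>)
  qed
  then have "weak_star_LIMSEQ (h \<circ> s) (Blinfun v)"
    using v by (simp add: weak_star_LIMSEQ_def bounded_linear_Blinfun_apply)
  with s show thesis by (rule that)
qed

text \<open>
  Uniform boundedness principle. The closed sets of points at which the whole sequence is bounded by
  \<open>n\<close> cover the space, so by Baire one of them contains a ball; on a ball around the origin the
  bound follows by taking differences.
\<close>

lemma weak_star_LIMSEQ_imp_bounded:
  fixes h :: "nat \<Rightarrow> 'a::banach dual"
  assumes "weak_star_LIMSEQ h l"
  obtains M where "\<And>k. norm (h k) \<le> M"
proof -
  define A where "A n = {y. \<forall>k. \<bar>h k y\<bar> \<le> real n}" for n
  have closed: "closed (A n)" for n
  proof -
    have "A n = (\<Inter>k. {y. \<bar>h k y\<bar> \<le> real n})"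
      by (auto simp: A_def)
    moreover have "closed {y. \<bar>h k y\<bar> \<le> real n}" for k
      by (intro closed_Collect_le continuous_intros)
    ultimately show ?thesis by auto
  qed
  have cover: "\<Union> (range A) = UNIV"
  proof -
    have "\<exists>n. y \<in> A n" for y
    proof -
      have "Bseq (\<lambda>k. h k y)"
        using assms convergent_imp_Bseq convergentI unfolding weak_star_LIMSEQ_def by blast
      then obtain K where K: "\<And>k. \<bar>h k y\<bar> \<le> K"
        by (auto simp: Bseq_def)
      obtain n :: nat where "K \<le> real n"
        using real_arch_simple by blast
      with K have "y \<in> A n"
        unfolding A_def by (auto intro: order_trans)
      then show ?thesis by blast
    qed
    then show ?thesis by auto
  qed
  have "\<exists>n. interior (A n) \<noteq> {}"
  proof (rule ccontr)
    assume "\<not> ?thesis"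
    then have "euclidean interior_of \<Union> (range A) = {}"
      using closed
      by (intro Baire_category_alt) (auto simp: completely_metrizable_space_euclidean)
    then show False using cover by simp
  qed
  then obtain n y e where e: "e > 0" and ball: "cball y e \<subseteq> A n"
    by (metis all_not_in_conv mem_interior_cball)
  have "norm (h k) \<le> 2 * real n / e" for k
  proof (rule norm_blinfun_bound)
    show "0 \<le> 2 * real n / e" using e by simp
    fix z :: 'a
    show "norm (h k z) \<le> 2 * real n / e * norm z"
    proof (cases "z = 0")
      case False
      have "y + e *\<^sub>R sgn z \<in> A n" "y \<in> A n"
        using ball e False by (auto simp: subset_iff dist_norm norm_sgn)
      then have "\<bar>h k y + e * h k (sgn z)\<bar> \<le> real n" "\<bar>h k y\<bar> \<le> real n"
        by (auto simp: A_def blinfun.add_right blinfun.scaleR_right)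
      then have "\<bar>e * h k (sgn z)\<bar> \<le> 2 * real n" by linarith
      moreover have "h k (sgn z) = h k z / norm z"
        by (simp add: sgn_div_norm blinfun.scaleR_right divide_inverse_commute)
      ultimately show ?thesis
        using e False by (simp add: abs_mult field_simps)
    qed simp
  qed
  then show thesis by (rule that)
qed

text \<open>
  Any number below the norm of the limit is beaten by the limit at some vector, hence by almost all
  members of the sequence at that same vector. The squared form is the one that quadratic growth uses.
\<close>

lemma weak_star_LIMSEQ_norm_power2_lsc:
  assumes lim: "weak_star_LIMSEQ h l" and b: "b < (norm l)\<^sup>2"
  shows "\<forall>\<^sub>F k in sequentially. b < (norm (h k))\<^sup>2"
proof (cases "b < 0")
  case True
  then have "b < (norm (h k))\<^sup>2" for k
    by (smt (verit) zero_le_power2)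
  then show ?thesis by simp
next
  case False
  define a where "a = sqrt b"
  have a: "0 \<le> a" "a\<^sup>2 = b" "a < norm l"
    using False b by (auto simp: a_def real_less_lsqrt)
  obtain y where y: "a * norm y < \<bar>l y\<bar>"
  proof (rule ccontr)
    assume "\<not> thesis"
    then have "norm (l y) \<le> a * norm y" for y
      using that[of y] by (cases "a * norm y < \<bar>l y\<bar>") auto
    then have "norm l \<le> a"
      by (rule norm_blinfun_bound[OF a(1)])
    with a show False by simp
  qed
  have "(\<lambda>k. \<bar>h k y\<bar>) \<longlonglongrightarrow> \<bar>l y\<bar>"
    using lim by (auto simp: weak_star_LIMSEQ_def intro: tendsto_rabs)
  then have "\<forall>\<^sub>F k in sequentially. a * norm y < \<bar>h k y\<bar>"
    using y by (rule order_tendstoD)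
  then show ?thesis
  proof eventually_elim
    case (elim k)
    then have "a * norm y < norm (h k) * norm y"
      using norm_blinfun[of "h k" y] by simp
    then have "a < norm (h k)"
      by (rule mult_right_less_imp_less) simp
    then show ?case
      using a by (metis power_strict_mono zero_less_numeral)
  qed
qed

lemma canonical_embedding_tendsto:
  assumes "\<phi> \<in> range canonical_embedding" "weak_star_LIMSEQ h l"
  shows "(\<lambda>k. blinfun_apply \<phi> (h k)) \<longlonglongrightarrow> blinfun_apply \<phi> l"
proof -
  obtain y where "\<phi> = canonical_embedding y"
    using assms(1) by blast
  with assms(2) show ?thesis
    by (simp add: canonical_embedding_apply weak_star_LIMSEQ_def)
qed

lemma LIMSEQ_imp_weak_star_LIMSEQ:
  "h \<longlonglongrightarrow> l \<Longrightarrow> weak_star_LIMSEQ h l"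
  unfolding weak_star_LIMSEQ_def by (auto intro!: tendsto_intros)

lemma weak_star_LIMSEQ_perturb:
  fixes h :: "'a::real_normed_vector dual"
  assumes "weak_star_LIMSEQ (\<lambda>k. t k *\<^sub>R r k) 0"
  shows "weak_star_LIMSEQ (\<lambda>k. h + (t k / 2) *\<^sub>R r k) h"
  unfolding weak_star_LIMSEQ_def
proof
  fix y
  have "(\<lambda>k. (t k *\<^sub>R r k) y) \<longlonglongrightarrow> (0 :: 'a dual) y"
    using assms unfolding weak_star_LIMSEQ_def by blast
  then have "(\<lambda>k. h y + (1/2) * ((t k *\<^sub>R r k) y)) \<longlonglongrightarrow> h y + (1/2) * (0 :: 'a dual) y"
    by (intro tendsto_add tendsto_mult tendsto_const)
  then show "(\<lambda>k. (h + (t k / 2) *\<^sub>R r k) y) \<longlonglongrightarrow> h y"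
    by (simp add: blinfun.bilinear_simps)
qed

section \<open>Quadratic growth bounds the curvature from below\<close>

text \<open>
  The bound is stated for a single admissible pair of sequences, with upper semicontinuity of the
  quadratic form only along these: in this form it serves both alternatives, as Mosco regularity
  controls nothing beyond one sequence.
\<close>

lemma quadratic_growth_imp_liminf_bound:
  fixes C :: "('a::banach) dual set"
    and J' :: "'a dual dual"
  assumes expan: "second_order_expansion C xb J J' J''"
    and growth: "c > 0" "\<epsilon> > 0" "\<forall>x \<in> C \<inter> cball xb \<epsilon>. J x \<ge> J xb + c / 2 * (norm (x - xb))\<^sup>2"
    and crit: "J' h = 0"
    and t: "pos_null_seq t"
    and r: "weak_star_LIMSEQ (\<lambda>k. t k *\<^sub>R r k) 0"
    and inC: "\<And>k. xb + t k *\<^sub>R h + ((1/2) * (t k)\<^sup>2) *\<^sub>R r k \<in> C"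
    and usc: "limsup (\<lambda>k. ereal (J'' (h + (t k / 2) *\<^sub>R r k) (h + (t k / 2) *\<^sub>R r k))) \<le> ereal (J'' h h)"
  shows "ereal (c * (norm h)\<^sup>2 - J'' h h) \<le> liminf (\<lambda>k. ereal (J' (r k)))"
proof -
  define g where "g k = h + (t k / 2) *\<^sub>R r k" for k
  have tpos: "t k > 0" and tlim: "t \<longlonglongrightarrow> 0" for k
    using t by (auto simp: pos_null_seq_def)
  have glim: "weak_star_LIMSEQ g h"
    unfolding g_def by (rule weak_star_LIMSEQ_perturb[OF r])
  have point: "xb + t k *\<^sub>R h + ((1/2) * (t k)\<^sup>2) *\<^sub>R r k = xb + t k *\<^sub>R g k" for k
    by (simp add: g_def algebra_simps power2_eq_square)
  have gC: "xb + t k *\<^sub>R g k \<in> C" for k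
    using inC[of k] unfolding point .
  have Jg: "J' (g k) = t k / 2 * J' (r k)" for k
    by (simp add: g_def blinfun.bilinear_simps crit)
  define \<rho> where "\<rho> k = (J (xb + t k *\<^sub>R g k) - J xb - t k * J' (g k)
      - (1/2) * (t k)\<^sup>2 * J'' (g k) (g k)) / (t k)\<^sup>2" for k
  have \<rho>: "\<rho> \<longlonglongrightarrow> 0"
    using expan t glim gC unfolding second_order_expansion_def \<rho>_def by blast
  \<comment> \<open>Growth is known only on a norm ball, so weak-star convergence of \<open>g\<close> must be shown to give
    norm convergence of the points \<open>xb + t k *\<^sub>R g k\<close>.\<close>
  obtain M where M: "\<And>k. norm (g k) \<le> M"
    using weak_star_LIMSEQ_imp_bounded[OF glim] by blast
  have "(\<lambda>k. t k * M) \<longlonglongrightarrow> 0"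
    using tendsto_mult[OF tlim tendsto_const[of M]] by simp
  then have "\<forall>\<^sub>F k in sequentially. t k * M < \<epsilon>"
    using growth(2) by (rule order_tendstoD)
  then have base: "\<forall>\<^sub>F k in sequentially.
      c * (norm (g k))\<^sup>2 - J'' (g k) (g k) - 2 * \<rho> k \<le> J' (r k)"
  proof eventually_elim
    case (elim k)
    have "t k * norm (g k) \<le> t k * M"
      using M tpos[of k] by (simp add: mult_left_mono)
    with elim have "t k * norm (g k) \<le> \<epsilon>" by simp
    then have "J (xb + t k *\<^sub>R g k) \<ge> J xb + c / 2 * (t k * norm (g k))\<^sup>2"
      using bspec[OF growth(3), of "xb + t k *\<^sub>R g k"] gC[of k] tpos[of k]
      by (simp add: dist_norm)
    moreover have "J (xb + t k *\<^sub>R g k) - J xb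
        = (t k)\<^sup>2 * (\<rho> k + J' (r k) / 2 + J'' (g k) (g k) / 2)"
      using tpos[of k] by (simp add: \<rho>_def Jg field_simps power2_eq_square)
    ultimately have "(t k)\<^sup>2 * (c / 2 * (norm (g k))\<^sup>2)
        \<le> (t k)\<^sup>2 * (\<rho> k + J' (r k) / 2 + J'' (g k) (g k) / 2)"
      by (simp add: power_mult_distrib algebra_simps)
    then have "c / 2 * (norm (g k))\<^sup>2 \<le> \<rho> k + J' (r k) / 2 + J'' (g k) (g k) / 2"
      by (rule mult_left_le_imp_le) (use tpos[of k] in simp)
    then show ?case by simp
  qed
  have ev: "\<forall>\<^sub>F k in sequentially. b < J' (r k)" if b: "b < c * (norm h)\<^sup>2 - J'' h h" for b
  proof -
    \<comment> \<open>The gap is split into four parts: one each for the norm and the quadratic form, one for twice the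
      remainder \<open>\<rho>\<close>, and one to spare.\<close>
    define d where "d = (c * (norm h)\<^sup>2 - J'' h h - b) / 4"
    have d: "d > 0" using b by (simp add: d_def)
    have "(norm h)\<^sup>2 - d / c < (norm h)\<^sup>2"
      using d growth(1) by simp
    from weak_star_LIMSEQ_norm_power2_lsc[OF glim this]
    have e1: "\<forall>\<^sub>F k in sequentially. c * (norm h)\<^sup>2 - d < c * (norm (g k))\<^sup>2"
      by eventually_elim (use growth(1) in \<open>simp add: field_simps\<close>)
    have "limsup (\<lambda>k. ereal (J'' (g k) (g k))) < ereal (J'' h h + d)"
      using usc d unfolding g_def by (rule_tac le_less_trans) auto
    from Limsup_lessD[OF this]
    have e2: "\<forall>\<^sub>F k in sequentially. J'' (g k) (g k) < J'' h h + d"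
      by simp
    have e3: "\<forall>\<^sub>F k in sequentially. \<rho> k < d / 2"
      using \<rho> d by (intro order_tendstoD(2)[of _ 0]) auto
    from base e1 e2 e3 show ?thesis
    proof eventually_elim
      case (elim k)
      have "b = c * (norm h)\<^sup>2 - J'' h h - 4 * d" by (simp add: d_def field_simps)
      with elim d show ?case by linarith
    qed
  qed
  have real_bound: "ereal b \<le> liminf (\<lambda>k. ereal (J' (r k)))"
    if "b < c * (norm h)\<^sup>2 - J'' h h" for b
  proof (rule Liminf_bounded)
    show "\<forall>\<^sub>F k in sequentially. ereal b \<le> ereal (J' (r k))"
      using ev[OF that]
      by eventually_elim simp
  qed
  show ?thesis
  proof (rule ccontr)
    assume "\<not> ?thesis"
    then have "liminf (\<lambda>k. ereal (J' (r k))) < ereal (c * (norm h)\<^sup>2 - J'' h h)"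
      by (rule not_le_imp_less)
    from ereal_dense2[OF this] obtain b where b: "liminf (\<lambda>k. ereal (J' (r k))) < ereal b"
      and "ereal b < ereal (c * (norm h)\<^sup>2 - J'' h h)"
      by auto
    then have "ereal b \<le> liminf (\<lambda>k. ereal (J' (r k)))"
      by (intro real_bound) simp
    with b show False
      using leD by blast
  qed
qed

text \<open>
  Under upper semicontinuity the liminf bound holds for every competitor and passes to the infimum;
  under Mosco regularity it is applied to the one sequence whose limit is the infimum, and boundedness of
  the bilinear form turns strong convergence of the directions into convergence of the quadratic form.
\<close>

lemma quadratic_growth_imp_positive_curvature:
  fixes C :: "('a::banach) dual set"
    and J' :: "'a dual dual"
  assumes bil: "bounded_bilinear J''"
    and expan: "second_order_expansion C xb J J' J''"
    and reg: "weak_star_usc (\<lambda>h. J'' h h) \<or> Mosco_regular C xb J'"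
    and growth: "c > 0" "\<epsilon> > 0" "\<forall>x \<in> C \<inter> cball xb \<epsilon>. J x \<ge> J xb + c / 2 * (norm (x - xb))\<^sup>2"
    and h: "h \<in> critical_cone C xb J'" "h \<noteq> 0"
  shows "directional_curvature C xb J' h + ereal (J'' h h) > 0"
proof -
  have crit: "J' h = 0" using h by (simp add: critical_cone_def)
  note bound = quadratic_growth_imp_liminf_bound[where J = J and J'' = J'', OF expan growth crit]
  have "ereal (c * (norm h)\<^sup>2 - J'' h h) \<le> directional_curvature C xb J' h"
    using reg
  proof
    assume usc: "weak_star_usc (\<lambda>h. J'' h h)"
    show ?thesis
      unfolding directional_curvature_def
    proof (rule Inf_greatest, clarify)
      fix r t
      assume t: "pos_null_seq t" and r: "weak_star_LIMSEQ (\<lambda>k. t k *\<^sub>R r k) 0"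
        and C: "\<forall>k. xb + t k *\<^sub>R h + ((1/2) * (t k)\<^sup>2) *\<^sub>R r k \<in> C"
      note weak_star_LIMSEQ_perturb[OF r, of h]
      with usc have "limsup (\<lambda>k. ereal (J'' (h + (t k / 2) *\<^sub>R r k) (h + (t k / 2) *\<^sub>R r k))) \<le> ereal (J'' h h)"
        unfolding weak_star_usc_def by blast
      from bound[OF t r _ this] C
      show "ereal (c * (norm h)\<^sup>2 - J'' h h) \<le> liminf (\<lambda>k. ereal (J' (r k)))" by blast
    qed
  next
    assume "Mosco_regular C xb J'"
    then obtain r t where t: "pos_null_seq t" and r: "(\<lambda>k. t k *\<^sub>R r k) \<longlonglongrightarrow> 0"
      and C: "\<And>k. xb + t k *\<^sub>R h + ((1/2) * (t k)\<^sup>2) *\<^sub>R r k \<in> C"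
      and Q: "(\<lambda>k. ereal (J' (r k))) \<longlonglongrightarrow> directional_curvature C xb J' h"
      using h(1) unfolding Mosco_regular_def by blast
    have "(\<lambda>k. h + (1/2) *\<^sub>R (t k *\<^sub>R r k)) \<longlonglongrightarrow> h + (1/2) *\<^sub>R 0"
      by (intro tendsto_intros r)
    then have g: "(\<lambda>k. h + (t k / 2) *\<^sub>R r k) \<longlonglongrightarrow> h" by simp
    have "(\<lambda>k. ereal (J'' (h + (t k / 2) *\<^sub>R r k) (h + (t k / 2) *\<^sub>R r k))) \<longlonglongrightarrow> ereal (J'' h h)"
      by (intro tendsto_ereal bounded_bilinear.tendsto[OF bil] g)
    from lim_imp_Limsup[OF _ this]
    have "limsup (\<lambda>k. ereal (J'' (h + (t k / 2) *\<^sub>R r k) (h + (t k / 2) *\<^sub>R r k))) \<le> ereal (J'' h h)"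
      by simp
    from bound[OF t LIMSEQ_imp_weak_star_LIMSEQ[OF r] C this]
    show ?thesis using lim_imp_Liminf[OF _ Q] by simp
  qed
  moreover have "c * (norm h)\<^sup>2 > 0" using growth(1) h(2) by simp
  ultimately show ?thesis
    by (cases "directional_curvature C xb J' h") auto
qed

section \<open>Positive curvature along critical directions yields quadratic growth\<close>

text \<open>
  Violating growth on the ball of radius \<open>1 / (n + 1)\<close> with constant \<open>1 / (n + 1)\<close> forces
  the difference quotients of second order to be asymptotically nonpositive. The weak-star limit
  comes from weak-star sequential compactness of bounded sequences, and it may be \<open>0\<close>.
\<close>

lemma no_quadratic_growth_sequence:
  fixes C :: "('a::real_normed_vector) dual set"
    and J' :: "'a dual dual"
  assumes sep: "separable_space (euclidean :: 'a topology)"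
    and expan: "second_order_expansion C xb J J' J''"
    and fail: "\<not> (\<exists>c>0. \<exists>\<epsilon>>0. \<forall>x \<in> C \<inter> cball xb \<epsilon>. J x \<ge> J xb + c / 2 * (norm (x - xb))\<^sup>2)"
  obtains t h l where "pos_null_seq t" "weak_star_LIMSEQ h l" "\<And>k. norm (h k) = 1"
    "\<And>k. xb + t k *\<^sub>R h k \<in> C"
    "\<And>d. d > 0 \<Longrightarrow> \<forall>\<^sub>F k in sequentially. J' (h k) / t k + (1/2) * J'' (h k) (h k) < d"
proof -
  have "\<exists>x. x \<in> C \<inter> cball xb (1 / real (Suc n)) \<and> J x < J xb + (1 / real (Suc n)) / 2 * (norm (x - xb))\<^sup>2" for n
  proof (rule ccontr)
    assume "\<not> ?thesis"
    then have "\<forall>x \<in> C \<inter> cball xb (1 / real (Suc n)). J x \<ge> J xb + (1 / real (Suc n)) / 2 * (norm (x - xb))\<^sup>2"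
      by (meson not_le)
    moreover have "1 / real (Suc n) > 0" by simp
    ultimately show False using fail by blast
  qed
  then obtain x where xC: "\<And>n. x n \<in> C" and xball: "\<And>n. x n \<in> cball xb (1 / real (Suc n))"
    and xJ: "\<And>n. J (x n) < J xb + (1 / real (Suc n)) / 2 * (norm (x n - xb))\<^sup>2"
    by (metis IntE)
  define t where "t n = norm (x n - xb)" for n
  define h where "h n = (x n - xb) /\<^sub>R t n" for n
  have xne: "x n \<noteq> xb" for n
    using xJ[of n] by auto
  then have tpos: "t n > 0" for n by (simp add: t_def)
  have tle: "t n \<le> 1 / real (Suc n)" for n
    using xball[of n] by (simp add: t_def dist_norm norm_minus_commute)
  have tlim: "t \<longlonglongrightarrow> 0"
  proof (rule tendsto_sandwich)
    show "\<forall>\<^sub>F n in sequentially. 0 \<le> t n" using tpos by (simp add: less_imp_le)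
    show "\<forall>\<^sub>F n in sequentially. t n \<le> 1 / real (Suc n)" using tle by simp
  qed (use LIMSEQ_Suc[OF lim_1_over_n] in \<open>auto\<close>)
  have h1: "norm (h n) = 1" for n
    using xne[of n] by (simp add: h_def t_def)
  have xh: "xb + t n *\<^sub>R h n = x n" for n
    using tpos[of n] by (simp add: h_def)
  obtain s l where s: "strict_mono (s :: nat \<Rightarrow> nat)" and l: "weak_star_LIMSEQ (h \<circ> s) l"
    using weak_star_convergent_subsequence[OF sep, of h 1] h1 by (metis order_refl)
  have ts: "pos_null_seq (t \<circ> s)"
    using tpos LIMSEQ_subseq_LIMSEQ[OF tlim s] by (auto simp: pos_null_seq_def)
  define \<rho> where "\<rho> k = (J (xb + (t \<circ> s) k *\<^sub>R (h \<circ> s) k) - J xb - (t \<circ> s) k * J' ((h \<circ> s) k)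
      - (1/2) * ((t \<circ> s) k)\<^sup>2 * J'' ((h \<circ> s) k) ((h \<circ> s) k)) / ((t \<circ> s) k)\<^sup>2" for k
  have "\<forall>k. xb + (t \<circ> s) k *\<^sub>R (h \<circ> s) k \<in> C" using xC xh by simp
  then have \<rho>: "\<rho> \<longlonglongrightarrow> 0"
    using expan ts l unfolding second_order_expansion_def \<rho>_def by blast
  have le: "J' (h (s k)) / t (s k) + (1/2) * J'' (h (s k)) (h (s k)) < 1 / real (Suc (s k)) / 2 - \<rho> k" for k
  proof -
    have "J (x (s k)) - J xb
        = (t (s k))\<^sup>2 * (\<rho> k + J' (h (s k)) / t (s k) + (1/2) * J'' (h (s k)) (h (s k)))"
      using tpos[of "s k"] by (simp add: \<rho>_def xh field_simps power2_eq_square)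
    then have "(t (s k))\<^sup>2 * (\<rho> k + J' (h (s k)) / t (s k) + (1/2) * J'' (h (s k)) (h (s k)))
        < (t (s k))\<^sup>2 * (1 / real (Suc (s k)) / 2)"
      using xJ[of "s k"] by (simp add: t_def mult.commute)
    then have "\<rho> k + J' (h (s k)) / t (s k) + (1/2) * J'' (h (s k)) (h (s k)) < 1 / real (Suc (s k)) / 2"
      by (rule mult_left_less_imp_less) simp
    then show ?thesis by simp
  qed
  have "(\<lambda>k. 1 / real (Suc (s k)) / 2 - \<rho> k) \<longlonglongrightarrow> 0 / 2 - 0"
    using LIMSEQ_subseq_LIMSEQ[OF LIMSEQ_Suc[OF lim_1_over_n] s] \<rho>
    by (intro tendsto_intros) (auto simp: o_def)
  then have ev: "\<forall>\<^sub>F k in sequentially. 1 / real (Suc (s k)) / 2 - \<rho> k < d" if "d > 0" for d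
    using that by (intro order_tendstoD(2)) auto
  show thesis
  proof (rule that[OF ts l])
    fix d :: real assume "d > 0"
    from ev[OF this]
    show "\<forall>\<^sub>F k in sequentially. J' ((h \<circ> s) k) / (t \<circ> s) k + (1/2) * J'' ((h \<circ> s) k) ((h \<circ> s) k) < d"
    proof eventually_elim
      case (elim k)
      with le[of k] show ?case by simp
    qed
  qed (use h1 xh xC in auto)
qed

text \<open>
  In the sequence violating growth, a zero limit contradicts non-degeneracy and a nonzero limit
  contradicts positive curvature. That the nonzero limit is critical uses both sides: the normal cone
  condition gives \<open>J' l \<ge> 0\<close>, while the bounded second order term leaves
  \<open>J' h\<^sub>k\<close> at most of order \<open>t\<^sub>k\<close>, whence \<open>J' l \<le> 0\<close>.
\<close>

lemma positive_curvature_imp_quadratic_growth: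
  fixes C :: "('a::real_normed_vector) dual set"
    and J' :: "'a dual dual"
  assumes sep: "separable_space (euclidean :: 'a topology)"
    and expan: "second_order_expansion C xb J J' J''"
    and embed: "J' \<in> range canonical_embedding"
    and bil: "bounded_bilinear J''"
    and lsc: "weak_star_lsc (\<lambda>h. J'' h h)"
    and normal: "J' \<in> uminus ` normal_cone C xb"
    and ndc: "non_degenerate C xb J' J''"
    and curv: "\<And>h. h \<in> critical_cone C xb J' \<Longrightarrow> h \<noteq> 0
                 \<Longrightarrow> directional_curvature C xb J' h + ereal (J'' h h) > 0"
  shows "\<exists>c>0. \<exists>\<epsilon>>0. \<forall>x \<in> C \<inter> cball xb \<epsilon>. J x \<ge> J xb + c / 2 * (norm (x - xb))\<^sup>2"
proof (rule ccontr)
  assume fail: "\<not> ?thesis"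
  obtain t h l where t: "pos_null_seq t" and hl: "weak_star_LIMSEQ h l"
    and h1: "\<And>k. norm (h k) = 1" and hC: "\<And>k. xb + t k *\<^sub>R h k \<in> C"
    and small: "\<And>d. d > 0 \<Longrightarrow> \<forall>\<^sub>F k in sequentially. J' (h k) / t k + (1/2) * J'' (h k) (h k) < d"
    by (rule no_quadratic_growth_sequence[OF sep expan fail]) blast
  have tpos: "t k > 0" and tlim: "t \<longlonglongrightarrow> 0" for k
    using t by (auto simp: pos_null_seq_def)
  have "l \<noteq> 0"
  proof
    assume "l = 0"
    then have "liminf (\<lambda>k. ereal (J' (h k /\<^sub>R t k) + (1/2) * J'' (h k) (h k))) > 0"
      using ndc t hl h1 hC unfolding non_degenerate_def by blast
    then obtain d where d: "0 < ereal d"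
      "ereal d < liminf (\<lambda>k. ereal (J' (h k /\<^sub>R t k) + (1/2) * J'' (h k) (h k)))"
      using ereal_dense2 by blast
    have J'scale: "J' (h k /\<^sub>R t k) = J' (h k) / t k" for k
      by (simp add: blinfun.scaleR_right divide_inverse_commute)
    have "d > 0" using d(1) by simp
    from less_LiminfD[OF d(2)] small[OF this]
    have "\<forall>\<^sub>F k in sequentially. False"
    proof eventually_elim
      case (elim k)
      then show ?case by (simp add: J'scale)
    qed
    then show False by simp
  qed
  have tangent: "l \<in> tangent_cone C xb"
  proof -
    have "(xb + t k *\<^sub>R h k - xb) /\<^sub>R t k = h k" for k
      using tpos[of k] by simp
    then show ?thesis
      unfolding tangent_cone_def using t hl hC
      by (auto intro!: exI[of _ t] exI[of _ "\<lambda>k. xb + t k *\<^sub>R h k"])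
  qed
  have J'lim: "(\<lambda>k. J' (h k)) \<longlonglongrightarrow> J' l"
    by (rule canonical_embedding_tendsto[OF embed hl])
  have "J' l \<ge> 0"
    using normal tangent by (auto simp: normal_cone_def blinfun.minus_left)
  moreover have "J' l \<le> 0"
  proof -
    obtain K where K: "\<And>a b. norm (J'' a b) \<le> norm a * norm b * K"
      using bounded_bilinear.bounded[OF bil] by blast
    have low: "- K \<le> J'' (h k) (h k)" for k
      using K[of "h k" "h k"] h1[of k] by simp
    have "\<forall>\<^sub>F k in sequentially. J' (h k) \<le> t k * (1 + K / 2)"
      using small[OF zero_less_one]
    proof eventually_elim
      case (elim k)
      then have "J' (h k) / t k \<le> 1 + K / 2" using low[of k] by simp
      then show ?case using tpos[of k] by (simp add: field_simps)
    qed
    moreover have "(\<lambda>k. t k * (1 + K / 2)) \<longlonglongrightarrow> 0 * (1 + K / 2)"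
      by (intro tendsto_intros tlim)
    ultimately show ?thesis
      using tendsto_le[OF _ _ J'lim, of "\<lambda>k. t k * (1 + K / 2)" 0] by simp
  qed
  ultimately have J'l: "J' l = 0" by simp
  with tangent have "l \<in> critical_cone C xb J'"
    by (simp add: critical_cone_def)
  with curv \<open>l \<noteq> 0\<close> have pos: "directional_curvature C xb J' l + ereal (J'' l l) > 0"
    by blast
  \<comment> \<open>Chosen so that the second order curve with direction \<open>l\<close> and correction \<open>r\<close> passes through
    exactly the points \<open>xb + t k *\<^sub>R h k\<close>.\<close>
  define r where "r k = (2 / t k) *\<^sub>R (h k - l)" for k
  have tr: "weak_star_LIMSEQ (\<lambda>k. t k *\<^sub>R r k) 0"
    unfolding weak_star_LIMSEQ_def
  proof
    fix y
    have "(\<lambda>k. 2 * (h k y - l y)) \<longlonglongrightarrow> 2 * (l y - l y)"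
      using hl unfolding weak_star_LIMSEQ_def
      by (intro tendsto_mult tendsto_diff tendsto_const) auto
    moreover have "(t k *\<^sub>R r k) y = 2 * (h k y - l y)" for k
      using tpos[of k] by (simp add: r_def blinfun.bilinear_simps)
    ultimately show "(\<lambda>k. (t k *\<^sub>R r k) y) \<longlonglongrightarrow> (0 :: 'a dual) y"
      by simp
  qed
  have rC: "xb + t k *\<^sub>R l + ((1/2) * (t k)\<^sup>2) *\<^sub>R r k \<in> C" for k
  proof -
    have "((1/2) * (t k)\<^sup>2) *\<^sub>R r k = t k *\<^sub>R (h k - l)"
      using tpos[of k] by (simp add: r_def power2_eq_square)
    then show ?thesis using hC[of k] by (simp add: algebra_simps)
  qed
  have J'r: "J' (r k) = 2 * (J' (h k) / t k)" for k
    by (simp add: r_def blinfun.bilinear_simps J'l)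
  have Q: "directional_curvature C xb J' l \<le> liminf (\<lambda>k. ereal (J' (r k)))"
    unfolding directional_curvature_def using t tr rC by (intro Inf_lower) blast
  \<comment> \<open>Since the curvature may be infinite, a real number strictly in between is used instead of its value.\<close>
  have "ereal (- J'' l l) < directional_curvature C xb J' l"
    using pos by (cases "directional_curvature C xb J' l") auto
  then obtain q where q: "ereal (- J'' l l) < ereal q" "ereal q < directional_curvature C xb J' l"
    using ereal_dense2 by blast
  define d where "d = (q + J'' l l) / 2"
  have d: "d > 0" using q(1) by (simp add: d_def)
  have e1: "\<forall>\<^sub>F k in sequentially. q < J' (r k)"
    using less_LiminfD[OF less_le_trans[OF q(2) Q]] by simp
  have "ereal (J'' l l - d) < liminf (\<lambda>k. ereal (J'' (h k) (h k)))"
  proof (rule less_le_trans)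
    show "ereal (J'' l l - d) < ereal (J'' l l)" using d by simp
    show "ereal (J'' l l) \<le> liminf (\<lambda>k. ereal (J'' (h k) (h k)))"
      using lsc hl unfolding weak_star_lsc_def by blast
  qed
  from less_LiminfD[OF this]
  have e2: "\<forall>\<^sub>F k in sequentially. J'' l l - d < J'' (h k) (h k)" by simp
  have "d / 2 > 0" using d by simp
  from small[OF this] e1 e2
  have "\<forall>\<^sub>F k in sequentially. False"
  proof eventually_elim
    case (elim k)
    have "q = 2 * d - J'' l l" by (simp add: d_def field_simps)
    with elim J'r[of k] show ?case by linarith
  qed
  then show False by simp
qed

section \<open>Second order characterisation of quadratic growth\<close>

theorem theorem4p5:
  fixes C :: "('a::banach) dual set"
    and xb :: "'a dual"
    and J :: "'a dual \<Rightarrow> real"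
    and J' :: "'a dual dual"
    and J'' :: "'a dual \<Rightarrow> 'a dual \<Rightarrow> real"
  assumes "separable_space (euclidean :: 'a topology)"
    and "closed C" and "C \<noteq> {}" and "xb \<in> C"
    and "J' \<in> range canonical_embedding"
    and "bounded_bilinear J''"
    and "second_order_expansion C xb J J' J''"
    and "weak_star_lsc (\<lambda>h. J'' h h)"
    and "J' \<in> uminus ` normal_cone C xb"
    and "non_degenerate C xb J' J''"
    and "weak_star_usc (\<lambda>h. J'' h h) \<or> Mosco_regular C xb J'"
  shows "(\<forall>h \<in> critical_cone C xb J' - {0}.
            directional_curvature C xb J' h + ereal (J'' h h) > 0)
     \<longleftrightarrow> (\<exists>c>0. \<exists>\<epsilon>>0. \<forall>x \<in> C \<inter> cball xb \<epsilon>.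
            J x \<ge> J xb + c / 2 * (norm (x - xb))\<^sup>2)" (is "?curv \<longleftrightarrow> ?growth")
proof
  assume ?curv
  then show ?growth
    by (intro positive_curvature_imp_quadratic_growth[where J' = J' and J'' = J'', OF assms(1,7,5,6,8,9,10)]) auto
next
  assume ?growth
  then obtain c \<epsilon> where "c > 0" "\<epsilon> > 0"
    and "\<forall>x \<in> C \<inter> cball xb \<epsilon>. J x \<ge> J xb + c / 2 * (norm (x - xb))\<^sup>2"
    by blast
  then show ?curv
    using quadratic_growth_imp_positive_curvature[OF assms(6,7,11)] by blast
qed

end
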